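(* Let $V:\mathbf{R}^d\to\mathbf{R}$ be a $\mathrm{C}^1$ function that is $L_V$-smooth for some $L_V>0$, i.e. $$V(y)-V(x)\le\langle\nabla V(x),y-x\rangle+\frac{L_V}{2}\|y-x\|^2\qquad\text{for all }x,y\in\mathbf{R}^d,$$ and let $\mathcal{V}(\mu):=\int V(x)\,\mathrm{d}\mu(x)$ for $\mu\in\mathcal{P}_2(\mathbf{R}^d)$, with gradient $\mathcal{G}_{\mathcal{V}}[\mu](x)=\nabla V(x)$. Then $\mathcal{V}$ is transport $L$-smooth with $L=L_V$.
   Context: $\mathcal{P}_2(\mathbf{R}^d)$ is the set of probability measures on $\mathbf{R}^d$ with finite second-order moment; $F_\#\mu$ is the push-forward of $\mu$ by $F$; $\|\cdot\|$, $\langle\cdot,\cdot\rangle$ are the Euclidean norm and inner product; $L^2(\mathbf{R}^d\to\mathbf{R}^d)$ is the set of maps $\mathbf{R}^d\to\mathbf{R}^d$ that are square integrable with respect to the base measure $\mu$. Transport $L$-smooth: a functional $\mathcal{F}:\mathcal{P}_2(\mathbf{R}^d)\to\mathbf{R}$ with gradient $\mathcal{G}_{\mathcal{F}}$ is transport $L$-smooth ($L>0$) if $\mathcal{F}(T_\#\mu)-\mathcal{F}(S_\#\mu)\le\int\langle\mathcal{G}_{\mathcal{F}}[S_\#\mu](S(x)),T(x)-S(x)\rangle\,\mathrm{d}\mu(x)+\frac L2\int\|T(x)-S(x)\|^2\,\mathrm{d}\mu(x)$ for any $S,T\in L^2(\mathbf{R}^d\to\mathbf{R}^d)$ and $\mu\in\mathcal{P}_2(\mathbf{R}^d)$.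 (Functionals are understood to be real-valued on $\mathcal{P}_2(\mathbf{R}^d)$.) *)

theory Defs
  imports "HOL-Probability.Probability"
begin

definition P2 :: "'a::euclidean_space measure set" where
  "P2 = {\<mu>. prob_space \<mu> \<and> sets \<mu> = sets borel \<and> integrable \<mu> (\<lambda>x. (norm x)\<^sup>2)}"

definition L2_maps :: "'a::euclidean_space measure \<Rightarrow> ('a \<Rightarrow> 'a) set" where
  "L2_maps \<mu> = {S. S \<in> borel_measurable \<mu> \<and> integrable \<mu> (\<lambda>x. (norm (S x))\<^sup>2)}"

abbreviation pushforward :: "('a::euclidean_space \<Rightarrow> 'a) \<Rightarrow> 'a measure \<Rightarrow> 'a measure" where
  "pushforward S \<mu> \<equiv> distr \<mu> borel S"

(* The functional F comes with its gradient G as a given datum. The integrability conjunct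
   says that the integral of the inner product exists; without it the Bochner integral
   would silently be 0. *)
definition transport_smooth ::
  "real \<Rightarrow> ('a::euclidean_space measure \<Rightarrow> real) \<Rightarrow> ('a measure \<Rightarrow> 'a \<Rightarrow> 'a) \<Rightarrow> bool" where
  "transport_smooth L F G \<longleftrightarrow> L > 0 \<and>
     (\<forall>\<mu>\<in>P2. \<forall>S\<in>L2_maps \<mu>. \<forall>T\<in>L2_maps \<mu>.
        integrable \<mu> (\<lambda>x. G (pushforward S \<mu>) (S x) \<bullet> (T x - S x)) \<and>
        F (pushforward T \<mu>) - F (pushforward S \<mu>)
          \<le> (\<integral>x. G (pushforward S \<mu>) (S x) \<bullet> (T x - S x) \<partial>\<mu>)
             + L / 2 * (\<integral>x. (norm (T x - S x))\<^sup>2 \<partial>\<mu>))"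

definition potential_energy :: "('a::euclidean_space \<Rightarrow> real) \<Rightarrow> 'a measure \<Rightarrow> real" where
  "potential_energy V \<mu> = (\<integral>x. V x \<partial>\<mu>)"

end

theory Submission
  imports Defs
begin

text \<open>Integrating the smoothness inequality of \<open>V\<close> at \<open>x = S\<close>, \<open>y = T\<close> gives the claim as soon as
  \<open>\<langle>\<nabla>V(S), T - S\<rangle>\<close> is integrable. The inequality at \<open>y = T\<close> bounds this product from below and the
  inequality at the reflected point \<open>y = S - (T - S)\<close> bounds it from above, both by integrable
  functions.\<close>

lemma pushforward_in_P2:
  assumes "\<mu> \<in> P2" "S \<in> L2_maps \<mu>"
  shows "pushforward S \<mu> \<in> P2"
  using assms by (auto simp: P2_def L2_maps_def integrable_distr_eq prob_space.prob_space_distr)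

lemma L2_maps_diff:
  assumes S: "S \<in> L2_maps \<mu>" and T: "T \<in> L2_maps \<mu>"
  shows "(\<lambda>x. T x - S x) \<in> L2_maps \<mu>"
proof -
  have [measurable]: "S \<in> borel_measurable \<mu>" "T \<in> borel_measurable \<mu>"
    using S T by (auto simp: L2_maps_def)
  have bound: "(norm (T x - S x))\<^sup>2 \<le> 2 * (norm (T x))\<^sup>2 + 2 * (norm (S x))\<^sup>2" for x
  proof -
    \<comment> \<open>This is the parallelogram law; dropping the nonnegative square of the sum
      leaves the desired bound.\<close>
    have "(norm (T x - S x))\<^sup>2 + (norm (T x + S x))\<^sup>2 = 2 * (norm (T x))\<^sup>2 + 2 * (norm (S x))\<^sup>2"
      by (simp add: power2_norm_eq_inner algebra_simps inner_commute)
    then show ?thesis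
      using zero_le_power2[of "norm (T x + S x)"] by linarith
  qed
  have "integrable \<mu> (\<lambda>x. 2 * (norm (T x))\<^sup>2 + 2 * (norm (S x))\<^sup>2)"
    using S T by (auto simp: L2_maps_def)
  then have "integrable \<mu> (\<lambda>x. (norm (T x - S x))\<^sup>2)"
    by (rule Bochner_Integration.integrable_bound) (use bound in auto)
  then show ?thesis
    by (simp add: L2_maps_def)
qed

text \<open>The bounds \<open>l\<close> and \<open>u\<close> may have either sign, so neither alone
  dominates \<open>f\<close> in absolute value; the sum of their absolute values does.\<close>

lemma integrable_sandwich:
  fixes f l u :: "'a \<Rightarrow> real"
  assumes "integrable M l" "integrable M u" "f \<in> borel_measurable M"
    and "\<And>x. l x \<le> f x" "\<And>x. f x \<le> u x"
  shows "integrable M f"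
proof (rule Bochner_Integration.integrable_bound)
  show "integrable M (\<lambda>x. \<bar>l x\<bar> + \<bar>u x\<bar>)"
    using assms(1,2) by simp
  have "\<bar>f x\<bar> \<le> \<bar>l x\<bar> + \<bar>u x\<bar>" for x
    using assms(4,5)[of x] by linarith
  then show "AE x in M. norm (f x) \<le> norm (\<bar>l x\<bar> + \<bar>u x\<bar>)"
    by auto
qed fact

theorem theorem4p7:
  fixes V :: "real ^ 'd \<Rightarrow> real" and gradV :: "real ^ 'd \<Rightarrow> real ^ 'd" and L\<^sub>V :: real
  assumes "\<And>x. GDERIV V x :> gradV x"
    and "continuous_on UNIV gradV"
    and "L\<^sub>V > 0"
    and "\<And>x y. V y - V x \<le> gradV x \<bullet> (y - x) + L\<^sub>V / 2 * (norm (y - x))\<^sup>2"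
    and "\<And>\<mu>. \<mu> \<in> P2 \<Longrightarrow> integrable \<mu> V"
  shows "transport_smooth L\<^sub>V (potential_energy V) (\<lambda>\<mu>. gradV)"
  unfolding transport_smooth_def
proof (intro conjI ballI)
  show "L\<^sub>V > 0" by fact
next
  fix \<mu> :: "(real ^ 'd) measure" and S T
  assume \<mu>: "\<mu> \<in> P2" and S: "S \<in> L2_maps \<mu>" and T: "T \<in> L2_maps \<mu>"
  have [measurable]: "gradV \<in> borel_measurable borel"
    using assms(2) by (rule borel_measurable_continuous_onI)
  \<comment> \<open>Differentiability gives continuity of \<open>V\<close>, hence the Borel
    measurability required for changing variables under a push-forward.\<close>
  have "continuous_on UNIV V"
    using assms(1) unfolding gderiv_def
    by (meson has_derivative_at_withinI has_derivative_continuous_on)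
  then have V[measurable]: "V \<in> borel_measurable borel"
    by (rule borel_measurable_continuous_onI)
  have [measurable]: "S \<in> borel_measurable \<mu>" "T \<in> borel_measurable \<mu>"
    using S T by (auto simp: L2_maps_def)
  \<comment> \<open>The push-forward of \<open>\<mu>\<close> by \<open>R\<close> lies in
    \<open>P2\<close>, so \<open>V\<close> is integrable against it; a change of variables moves
    this back to \<open>\<mu>\<close>.\<close>
  have V_int: "integrable \<mu> (\<lambda>x. V (R x))" if "R \<in> L2_maps \<mu>" for R
    using assms(5)[OF pushforward_in_P2[OF \<mu> that]] that V
    by (subst (asm) integrable_distr_eq) (auto simp: L2_maps_def)
  have energy: "potential_energy V (pushforward R \<mu>) = (\<integral>x. V (R x) \<partial>\<mu>)"
    if "R \<in> L2_maps \<mu>" for R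
    using that V by (auto simp: potential_energy_def L2_maps_def integral_distr)
  have D: "(\<lambda>x. T x - S x) \<in> L2_maps \<mu>"
    using S T by (rule L2_maps_diff)
  \<comment> \<open>The third fact concerns the reflected map \<open>S - (T - S)\<close>, which is
    square integrable as a difference of \<open>S\<close> and \<open>T - S\<close>.\<close>
  note V_ints = V_int[OF S] V_int[OF T] V_int[OF L2_maps_diff[OF D S]]
  have D_int: "integrable \<mu> (\<lambda>x. L\<^sub>V / 2 * (norm (T x - S x))\<^sup>2)"
    using D by (simp add: L2_maps_def)
  have lower: "V (T x) - V (S x) - L\<^sub>V / 2 * (norm (T x - S x))\<^sup>2 \<le> gradV (S x) \<bullet> (T x - S x)" for x
    using assms(4)[of "T x" "S x"] by linarith
  have upper: "gradV (S x) \<bullet> (T x - S x)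
      \<le> V (S x) - V (S x - (T x - S x)) + L\<^sub>V / 2 * (norm (T x - S x))\<^sup>2" for x
  proof -
    \<comment> \<open>Reversing the displacement flips the sign of the inner product but keeps the
      quadratic term, so smoothness now bounds the product from above.\<close>
    have reflect: "S x - (T x - S x) - S x = - (T x - S x)" by simp
    show ?thesis
      using assms(4)[of "S x - (T x - S x)" "S x"]
      unfolding reflect inner_minus_right norm_minus_cancel by linarith
  qed
  show inner_int: "integrable \<mu> (\<lambda>x. gradV (S x) \<bullet> (T x - S x))"
  proof (rule integrable_sandwich[OF _ _ _ lower upper])
    show "(\<lambda>x. gradV (S x) \<bullet> (T x - S x)) \<in> borel_measurable \<mu>" by measurable
  qed (intro Bochner_Integration.integrable_add Bochner_Integration.integrable_diff V_ints D_int)+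
  \<comment> \<open>Monotonicity of the Bochner integral needs both sides integrable;
    \<open>inner_int\<close> supplies this for the right side and lets the integral be split
    afterwards.\<close>
  have "(\<integral>x. V (T x) - V (S x) \<partial>\<mu>)
      \<le> (\<integral>x. gradV (S x) \<bullet> (T x - S x) + L\<^sub>V / 2 * (norm (T x - S x))\<^sup>2 \<partial>\<mu>)"
    by (intro integral_mono Bochner_Integration.integrable_add Bochner_Integration.integrable_diff
        V_ints D_int inner_int assms(4))
  then show "potential_energy V (pushforward T \<mu>) - potential_energy V (pushforward S \<mu>)
      \<le> (\<integral>x. gradV (S x) \<bullet> (T x - S x) \<partial>\<mu>) + L\<^sub>V / 2 * (\<integral>x. (norm (T x - S x))\<^sup>2 \<partial>\<mu>)"
    using V_ints D_int inner_int by (simp add: energy S T)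
qed

end
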